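(* Let $f(z)=z+\sum_{n=2}^{\infty}a_nz^n\in\mathcal{C}_{Ne}$. Then $$\sum_{n=2}^{\infty}n^2\left((3n)^2-7^2\right)|a_n|^2\leq 40.$$
   Context: $\mathbb{D}$ is the open unit disk. $\mathcal{A}$ is the set of analytic functions $f$ on $\mathbb{D}$ with $f(0)=0$ and $f'(0)=1$. For analytic $f,g$ on $\mathbb{D}$, $f\prec g$ means there is an analytic $w$ on $\mathbb{D}$ with $w(0)=0$, $|w(z)|<1$ and $f(z)=g(w(z))$ on $\mathbb{D}$. $\mathcal{C}_{Ne}=\{f\in\mathcal{A}: 1+zf''(z)/f'(z)\prec 1+z-z^3/3\}$. *)

theory Defs
  imports "HOL-Complex_Analysis.Complex_Analysis"
begin

abbreviation unit_disk :: "complex set" ("\<D>") where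
  "\<D> \<equiv> ball 0 1"

definition class_A :: "(complex \<Rightarrow> complex) set" where
  "class_A = {f. f analytic_on \<D> \<and> f 0 = 0 \<and> deriv f 0 = 1}"

definition subordinate :: "(complex \<Rightarrow> complex) \<Rightarrow> (complex \<Rightarrow> complex) \<Rightarrow> bool"
    (infix "\<prec>" 50) where
  "f \<prec> g \<longleftrightarrow> f analytic_on \<D> \<and> g analytic_on \<D> \<and>
     (\<exists>w. w analytic_on \<D> \<and> w 0 = 0 \<and> (\<forall>z\<in>\<D>. norm (w z) < 1) \<and> (\<forall>z\<in>\<D>. f z = g (w z)))"

text \<open>
  The quotient below is taken in a total field, with value 0 where \<open>deriv f\<close> vanishes.
  This admits no extra functions: near a zero of \<open>deriv f\<close> in the disk (which is isolated and
  different from the origin, as \<open>deriv f 0 = 1\<close>) the quotient is unbounded, whereas the left-hand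
  side of a subordination is required to be analytic on the whole disk.
\<close>

definition class_CNe :: "(complex \<Rightarrow> complex) set" where
  "class_CNe = {f \<in> class_A.
     (\<lambda>z. 1 + z * deriv (deriv f) z / deriv f z) \<prec> (\<lambda>z. 1 + z - z ^ 3 / 3)}"

end

theory Submission
  imports Defs
begin

text \<open>
  Write \<open>g(z) = z f'(z) = \<Sum> n a\<^sub>n z\<^sup>n\<close> with \<open>a\<^sub>1 = 1\<close>. Subordination gives \<open>z g' = g \<cdot> (1 + w - w\<^sup>3/3)\<close>
  with \<open>\<bar>w\<bar> < 1\<close>, so \<open>\<bar>z g'\<bar> \<le> (7/3) \<bar>g\<bar>\<close> on the disk. Comparing the mean squares of both sides on
  \<open>\<bar>z\<bar> = r\<close> by Parseval's identity yields \<open>\<Sum>\<^bsub>n\<ge>1\<^esub> n\<^sup>2 (9 n\<^sup>2 - 49) \<bar>a\<^sub>n\<bar>\<^sup>2 r\<^bsup>2n\<^esup> \<le> 0\<close>, whose term \<open>n = 1\<close>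
  is \<open>-40 r\<^sup>2\<close>. Only the terms \<open>n = 1, 2\<close> can be negative, so partial sums obey the same bound and
  \<open>r \<longrightarrow> 1\<close> is harmless.
\<close>

section \<open>Parseval's identity on circles inside the disk\<close>

lemma has_integral_cis_int:
  "((\<lambda>t. cis (of_int k * t)) has_integral (if k = 0 then complex_of_real (2 * pi) else 0)) {0..2 * pi}"
proof (cases "k = 0")
  case True
  then show ?thesis
    using has_integral_const_real[of "1::complex" 0 "2 * pi"] by (simp add: scaleR_conv_of_real)
next
  case False
  have "((\<lambda>t. cis (of_int k * t)) has_integral
      (cis (of_int k * (2 * pi)) / (\<i> * of_int k) - cis (of_int k * 0) / (\<i> * of_int k))) {0..2 * pi}"
  proof (rule fundamental_theorem_of_calculus)
    fix t assume "t \<in> {0..2 * pi}"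
    show "((\<lambda>t. cis (of_int k * t) / (\<i> * of_int k)) has_vector_derivative cis (of_int k * t))
        (at t within {0..2 * pi})"
      unfolding has_vector_derivative_def
      by (rule derivative_eq_intros refl | simp add: False scaleR_conv_of_real fun_eq_iff field_simps)+
  qed simp
  moreover have "cis (of_int k * (2 * pi)) = 1"
    by (metis cis_multiple_2pi Ints_of_int mult.commute)
  ultimately show ?thesis
    using False by simp
qed

text \<open>Writing the square as the sum times its conjugate gives a double sum of exponentials
  with integer frequencies \<open>int m - int n\<close>; orthogonality leaves only the
  diagonal.\<close>

lemma has_integral_norm_square_trig_poly:
  fixes b :: "nat \<Rightarrow> complex"
  shows "((\<lambda>t. (norm (\<Sum>n<N. b n * cis (real n * t)))\<^sup>2) has_integral
    2 * pi * (\<Sum>n<N. (norm (b n))\<^sup>2)) {0..2 * pi}"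
proof -
  let ?I = "\<lambda>k::int. if k = 0 then complex_of_real (2 * pi) else 0"
  have "((\<lambda>t. \<Sum>m<N. \<Sum>n<N. b m * cnj (b n) * cis (of_int (int m - int n) * t)) has_integral
      (\<Sum>m<N. \<Sum>n<N. b m * cnj (b n) * ?I (int m - int n))) {0..2 * pi}"
    by (intro has_integral_sum has_integral_mult_right has_integral_cis_int finite_lessThan)
  moreover have "(\<Sum>m<N. \<Sum>n<N. b m * cnj (b n) * cis (of_int (int m - int n) * t)) =
      of_real ((norm (\<Sum>n<N. b n * cis (real n * t)))\<^sup>2)" for t
    unfolding complex_norm_square
    by (simp add: sum_product cis_cnj algebra_simps cis_mult)
  moreover have "(\<Sum>m<N. \<Sum>n<N. b m * cnj (b n) * ?I (int m - int n)) =
      of_real (2 * pi * (\<Sum>n<N. (norm (b n))\<^sup>2))"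
  proof -
    have "(\<Sum>n<N. b m * cnj (b n) * ?I (int m - int n)) = of_real (2 * pi * (norm (b m))\<^sup>2)"
      if "m < N" for m
    proof -
      have "(\<Sum>n<N. b m * cnj (b n) * ?I (int m - int n)) =
          (\<Sum>n<N. if n = m then b m * cnj (b m) * of_real (2 * pi) else 0)"
        by (intro sum.cong) auto
      also have "\<dots> = of_real (2 * pi) * (b m * cnj (b m))"
        using that by simp
      finally show ?thesis
        by (simp only: of_real_mult complex_norm_square)
    qed
    then show ?thesis
      by (simp add: sum_distrib_left)
  qed
  ultimately have "((\<lambda>t. complex_of_real ((norm (\<Sum>n<N. b n * cis (real n * t)))\<^sup>2)) has_integral
      of_real (2 * pi * (\<Sum>n<N. (norm (b n))\<^sup>2))) {0..2 * pi}"
    by (simp only:)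
  from has_integral_Re[OF this] show ?thesis
    by simp
qed

text \<open>On a circle of radius \<open>r < 1\<close> the partial sums are trigonometric
  polynomials converging uniformly, so their mean squares converge to that of
  \<open>h\<close>.\<close>

lemma parseval_power_series:
  fixes c :: "nat \<Rightarrow> complex"
  assumes h: "\<And>z. norm z < 1 \<Longrightarrow> (\<lambda>n. c n * z ^ n) sums h z" and r: "0 \<le> r" "r < 1"
  obtains J where "((\<lambda>t. (norm (h (of_real r * cis t)))\<^sup>2) has_integral J) {0..2 * pi}"
    and "(\<lambda>n. 2 * pi * ((norm (c n))\<^sup>2 * r ^ (2 * n))) sums J"
proof -
  define b where "b n = c n * of_real r ^ n" for n
  let ?T = "\<lambda>n t. b n * cis (real n * t)" and ?H = "\<lambda>t. h (of_real r * cis t)"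
  have T: "?T n t = c n * (of_real r * cis t) ^ n" for n t
    unfolding b_def power_mult_distrib Complex.DeMoivre by (simp add: mult.assoc)
  \<comment> \<open>Convergence at a point of larger modulus \<open>s\<close> gives absolute
    convergence at radius \<open>r\<close>, the majorant for the Weierstrass test.\<close>
  obtain s where s: "r < s" "s < 1"
    using dense r by blast
  have sm: "summable (\<lambda>n. norm (b n))"
    unfolding b_def
    by (rule powser_insidea[where x = "of_real s"]) (use h[of "of_real s"] r s in \<open>auto simp: sums_iff\<close>)
  have lim: "uniform_limit {0..2 * pi} (\<lambda>N t. \<Sum>n<N. ?T n t) ?H sequentially"
  proof -
    have "uniform_limit {0..2 * pi} (\<lambda>N t. \<Sum>n<N. ?T n t) (\<lambda>t. \<Sum>n. ?T n t) sequentially"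
      by (rule Weierstrass_m_test[OF _ sm]) (simp add: norm_mult)
    moreover have "(\<Sum>n. ?T n t) = ?H t" for t
      unfolding T using h[of "of_real r * cis t"] r by (simp add: sums_iff norm_mult)
    ultimately show ?thesis
      by simp
  qed
  have cont: "continuous_on {0..2 * pi} ?H"
    by (rule uniform_limit_theorem[OF _ lim]) (auto intro!: always_eventually continuous_intros)
  then have bdd: "bounded (?H ` {0..2 * pi})"
    by (intro compact_imp_bounded compact_continuous_image) auto
  \<comment> \<open>Seen as an inner product, the squared norm is bilinear; uniform limits pass
    through it because the limit function is bounded.\<close>
  have "uniform_limit {0..2 * pi} (\<lambda>N t. (norm (\<Sum>n<N. ?T n t))\<^sup>2) (\<lambda>t. (norm (?H t))\<^sup>2) sequentially"
    unfolding power2_norm_eq_inner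
    by (rule bounded_bilinear.bounded_uniform_limit[OF bounded_bilinear_inner lim lim bdd bdd])
  then obtain I J where I: "\<And>N. ((\<lambda>t. (norm (\<Sum>n<N. ?T n t))\<^sup>2) has_integral I N) {0..2 * pi}"
    and J: "((\<lambda>t. (norm (?H t))\<^sup>2) has_integral J) {0..2 * pi}" and IJ: "I \<longlonglongrightarrow> J"
    by (rule uniform_limit_integral) (auto intro!: continuous_intros)
  have "I N = (\<Sum>n<N. 2 * pi * ((norm (c n))\<^sup>2 * r ^ (2 * n)))" for N
    using has_integral_unique[OF I has_integral_norm_square_trig_poly] r
    by (simp add: b_def norm_mult norm_power power_mult_distrib sum_distrib_left mult.commute[of 2]
        flip: power_mult)
  then have "I = (\<lambda>N. \<Sum>n<N. 2 * pi * ((norm (c n))\<^sup>2 * r ^ (2 * n)))"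
    by (rule ext)
  with IJ have "(\<lambda>n. 2 * pi * ((norm (c n))\<^sup>2 * r ^ (2 * n))) sums J"
    by (simp only: sums_def)
  with J show thesis
    by (rule that)
qed

text \<open>The squared pointwise bound is integrated over the circle of radius \<open>r\<close>,
  and Parseval's identity turns both sides into coefficient sums.\<close>

lemma power_series_coeff_square_mono:
  fixes c d :: "nat \<Rightarrow> complex"
  assumes g: "\<And>z. norm z < 1 \<Longrightarrow> (\<lambda>n. c n * z ^ n) sums g z"
    and h: "\<And>z. norm z < 1 \<Longrightarrow> (\<lambda>n. d n * z ^ n) sums h z"
    and le: "\<And>z. norm z < 1 \<Longrightarrow> norm (h z) \<le> K * norm (g z)"
    and r: "0 \<le> r" "r < 1"
  obtains S where "(\<lambda>n. ((norm (d n))\<^sup>2 - K\<^sup>2 * (norm (c n))\<^sup>2) * r ^ (2 * n)) sums S" "S \<le> 0"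
proof -
  obtain J1 where J1: "((\<lambda>t. (norm (g (of_real r * cis t)))\<^sup>2) has_integral J1) {0..2 * pi}"
    "(\<lambda>n. 2 * pi * ((norm (c n))\<^sup>2 * r ^ (2 * n))) sums J1"
    using parseval_power_series[OF g r] by blast
  obtain J2 where J2: "((\<lambda>t. (norm (h (of_real r * cis t)))\<^sup>2) has_integral J2) {0..2 * pi}"
    "(\<lambda>n. 2 * pi * ((norm (d n))\<^sup>2 * r ^ (2 * n))) sums J2"
    using parseval_power_series[OF h r] by blast
  have "J2 \<le> K\<^sup>2 * J1"
  proof (rule has_integral_le[OF J2(1) has_integral_mult_right[OF J1(1)]])
    fix t
    show "(norm (h (of_real r * cis t)))\<^sup>2 \<le> K\<^sup>2 * (norm (g (of_real r * cis t)))\<^sup>2"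
      unfolding power_mult_distrib[symmetric]
      by (intro power_mono le) (use r in \<open>auto simp: norm_mult\<close>)
  qed
  moreover have "(\<lambda>n. ((norm (d n))\<^sup>2 - K\<^sup>2 * (norm (c n))\<^sup>2) * r ^ (2 * n)) sums ((J2 - K\<^sup>2 * J1) / (2 * pi))"
    using sums_divide[OF sums_diff[OF J2(2) sums_mult[OF J1(2), of "K\<^sup>2"]], of "2 * pi"]
    by (simp add: algebra_simps diff_divide_distrib)
  ultimately show thesis
    by (intro that) (auto simp: divide_nonpos_pos)
qed

section \<open>The operator \<open>z d/dz\<close> and the bound from subordination\<close>

lemma sums_mult_deriv:
  fixes c :: "nat \<Rightarrow> complex"
  assumes h: "\<And>z. norm z < 1 \<Longrightarrow> (\<lambda>n. c n * z ^ n) sums h z"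
    and "h holomorphic_on ball 0 1" and z: "norm z < 1"
  shows "(\<lambda>n. of_nat n * c n * z ^ n) sums (z * deriv h z)"
proof -
  have "(\<lambda>n. diffs c n * z ^ n) sums deriv h z"
    by (rule termdiffs_sums_strong[OF h _ z]) (use assms in \<open>auto intro: holomorphic_derivI\<close>)
  from sums_mult[OF this, of z]
  have "(\<lambda>n. of_nat (Suc n) * c (Suc n) * z ^ Suc n) sums (z * deriv h z)"
    by (simp add: diffs_def mult_ac)
  then show ?thesis
    \<comment> \<open>The term of index 0 carries the factor 0, so restoring it leaves the sum
      unchanged.\<close>
    by (subst (asm) sums_Suc_iff) simp
qed

lemma class_CNe_norm_le:
  assumes f: "f \<in> class_CNe" and z: "norm z < 1"
  shows "norm (z * deriv (\<lambda>u. u * deriv f u) z) \<le> 7 / 3 * norm (z * deriv f z)"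
proof -
  \<comment> \<open>The value \<open>deriv f 0 = 1\<close> shows that \<open>deriv f\<close> is not
    identically zero, hence has isolated zeros.\<close>
  from f have hol: "f holomorphic_on \<D>" and f1: "deriv f 0 = 1"
    by (auto simp: class_CNe_def class_A_def analytic_imp_holomorphic)
  obtain w where w: "\<And>u. u \<in> \<D> \<Longrightarrow> norm (w u) < 1"
    "\<And>u. u \<in> \<D> \<Longrightarrow> 1 + u * deriv (deriv f) u / deriv f u = 1 + w u - w u ^ 3 / 3"
    using f unfolding class_CNe_def subordinate_def by blast
  have hol1: "deriv f holomorphic_on \<D>"
    using hol by (intro holomorphic_deriv) auto
  have hol2: "(\<lambda>u. u * deriv f u) holomorphic_on \<D>"
    using hol by (intro holomorphic_intros) auto
  have hol3: "deriv (\<lambda>u. u * deriv f u) holomorphic_on \<D>"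
    using hol2 by (intro holomorphic_deriv) auto
  let ?L = "\<lambda>u. norm (u * deriv (\<lambda>u. u * deriv f u) u)" and ?R = "\<lambda>u. 7 / 3 * norm (u * deriv f u)"
  have le: "?L u \<le> ?R u" if u: "u \<in> \<D>" and nz: "deriv f u \<noteq> 0" for u
  proof -
    have "(deriv f has_field_derivative deriv (deriv f) u) (at u)"
      using hol1 u by (intro holomorphic_derivI) auto
    then have "((\<lambda>u. u * deriv f u) has_field_derivative deriv f u + u * deriv (deriv f) u) (at u)"
      by (auto intro!: derivative_eq_intros)
    then have "deriv (\<lambda>u. u * deriv f u) u = deriv f u + u * deriv (deriv f) u"
      by (rule DERIV_imp_deriv)
    also have "\<dots> = deriv f u * (1 + u * deriv (deriv f) u / deriv f u)"
      using nz by (simp add: field_simps)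
    also have "\<dots> = deriv f u * (1 + w u - w u ^ 3 / 3)"
      by (simp only: w(2)[OF u])
    finally have eq: "deriv (\<lambda>u. u * deriv f u) u = deriv f u * (1 + w u - w u ^ 3 / 3)" .
    \<comment> \<open>As \<open>norm (w u) < 1\<close>, the constant is 7/3 = 1 + 1 + 1/3.\<close>
    have "norm (1 + w u - w u ^ 3 / 3) \<le> norm (1 + w u) + norm (w u ^ 3 / 3)"
      by (rule norm_triangle_ineq4)
    also have "\<dots> \<le> (norm (1::complex) + norm (w u)) + norm (w u) ^ 3 / 3"
      by (intro add_mono norm_triangle_ineq) (simp add: norm_divide norm_power)
    also have "\<dots> \<le> 7 / 3"
      using w(1)[OF u] power_le_one[of "norm (w u)" 3] by simp
    finally have "norm (u * deriv f u) * norm (1 + w u - w u ^ 3 / 3) \<le> norm (u * deriv f u) * (7 / 3)"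
      by (intro mult_left_mono) auto
    then show ?thesis
      by (simp add: eq norm_mult mult_ac)
  qed
  \<comment> \<open>Nothing is known at a zero of \<open>deriv f\<close>, where the quotient is junk; zeros being isolated, the
    inequality extends to them by continuity.\<close>
  have "\<forall>\<^sub>F u in at z. deriv f u \<noteq> 0 \<and> u \<in> \<D>"
    using z by (intro non_zero_neighbour_alt[OF hol1, where \<beta> = 0]) (auto simp: f1)
  then have ev: "\<forall>\<^sub>F u in at z. ?L u \<le> ?R u"
    by eventually_elim (use le in auto)
  have "isCont (deriv f) z" "isCont (deriv (\<lambda>u. u * deriv f u)) z"
    using hol1 hol3 z by (auto simp: continuous_on_eq_continuous_at dest!: holomorphic_on_imp_continuous_on)
  then have "(?L \<longlongrightarrow> ?L z) (at z)" "(?R \<longlongrightarrow> ?R z) (at z)"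
    unfolding isCont_def by (auto intro!: tendsto_intros)
  from tendsto_le[OF _ this(2,1) ev] show ?thesis
    by simp
qed

section \<open>Passage to radius one and the final estimate\<close>

text \<open>For \<open>r < 1\<close>, dropping the nonnegative tail keeps the sum at most 0. What
  remains is a polynomial in \<open>r\<close>, so \<open>r\<close> may tend to 1 without any
  convergence there.\<close>

lemma sum_le_zero_of_abel_means:
  fixes d :: "nat \<Rightarrow> real"
  assumes S: "\<And>r. 0 \<le> r \<Longrightarrow> r < 1 \<Longrightarrow> \<exists>S. (\<lambda>n. d n * r ^ (2 * n)) sums S \<and> S \<le> 0"
    and nonneg: "\<And>n. n \<ge> N \<Longrightarrow> d n \<ge> 0"
  shows "(\<Sum>n<N. d n) \<le> 0"
proof -
  have "(\<Sum>n<N. d n * r ^ (2 * n)) \<le> 0" if r: "0 < r" "r < 1" for r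
  proof -
    obtain T where T: "(\<lambda>n. d n * r ^ (2 * n)) sums T" "T \<le> 0"
      using S[of r] r by auto
    have "(\<Sum>n<N. d n * r ^ (2 * n)) \<le> (\<Sum>n. d n * r ^ (2 * n))"
      using T r by (intro sum_le_suminf) (auto simp: sums_iff nonneg)
    with T show ?thesis
      by (simp add: sums_iff)
  qed
  moreover have "\<forall>\<^sub>F r in at_left (1::real). 0 < r \<and> r < 1"
    using eventually_at_left_real[of 0 "1::real"] by simp
  ultimately have "\<forall>\<^sub>F r in at_left (1::real). (\<Sum>n<N. d n * r ^ (2 * n)) \<le> 0"
    by (auto elim: eventually_mono)
  moreover have "((\<lambda>r. \<Sum>n<N. d n * r ^ (2 * n)) \<longlongrightarrow> (\<Sum>n<N. d n * 1 ^ (2 * n))) (at_left (1::real))"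
    by (intro tendsto_intros)
  ultimately show ?thesis
    using tendsto_upperbound[of _ _ "at_left (1::real)" 0] by fastforce
qed

theorem theorem4p2:
  fixes f :: "complex \<Rightarrow> complex" and a :: "nat \<Rightarrow> complex"
  assumes "f \<in> class_CNe"
    and "\<And>z. z \<in> \<D> \<Longrightarrow> (\<lambda>n. a (n + 2) * z ^ (n + 2)) sums (f z - z)"
  shows "summable (\<lambda>n. (real (n + 2))\<^sup>2 * ((3 * real (n + 2))\<^sup>2 - 7\<^sup>2) * (norm (a (n + 2)))\<^sup>2)
    \<and> (\<Sum>n. (real (n + 2))\<^sup>2 * ((3 * real (n + 2))\<^sup>2 - 7\<^sup>2) * (norm (a (n + 2)))\<^sup>2) \<le> 40"
proof -
  \<comment> \<open>The hypothesis says nothing about \<open>a 0\<close> and \<open>a 1\<close>;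
    \<open>c\<close> puts the true Taylor coefficients 0 and 1 there.\<close>
  define c where "c n = (if n = 0 then 0 else if n = 1 then 1 else a n)" for n
  define d where "d n = (real n)\<^sup>2 * ((3 * real n)\<^sup>2 - 7\<^sup>2) * (norm (c n))\<^sup>2" for n
  define e where "e n = d (n + 2)" for n
  let ?g = "\<lambda>z. z * deriv f z"
  have hol: "f holomorphic_on \<D>"
    using assms(1) by (auto simp: class_CNe_def class_A_def analytic_imp_holomorphic)
  have f: "(\<lambda>n. c n * z ^ n) sums f z" if "norm z < 1" for z
  proof -
    have "(\<lambda>n. c (n + 2) * z ^ (n + 2)) sums (f z - (\<Sum>n<2. c n * z ^ n))"
      using assms(2)[of z] that by (simp add: c_def numeral_2_eq_2)
    then show ?thesis
      by (subst (asm) sums_iff_shift') simp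
  qed
  have g: "(\<lambda>n. of_nat n * c n * z ^ n) sums ?g z" if "norm z < 1" for z
    using sums_mult_deriv[OF f hol that] .
  have "?g holomorphic_on \<D>"
    using hol by (intro holomorphic_intros holomorphic_deriv) auto
  then have h: "(\<lambda>n. of_nat n * (of_nat n * c n) * z ^ n) sums (z * deriv ?g z)" if "norm z < 1" for z
    using sums_mult_deriv[OF g _ that] by blast
  have "\<exists>S. (\<lambda>n. d n * r ^ (2 * n)) sums S \<and> S \<le> 0" if r: "0 \<le> r" "r < 1" for r
  proof -
    obtain S where S: "S \<le> 0"
      "(\<lambda>n. ((norm (of_nat n * (of_nat n * c n)))\<^sup>2 - (7 / 3)\<^sup>2 * (norm (of_nat n * c n))\<^sup>2) * r ^ (2 * n)) sums S"
      using power_series_coeff_square_mono[OF g h class_CNe_norm_le[OF assms(1)] r] by blast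
    \<comment> \<open>The factor 9 clears the denominator of \<open>(7 / 3)\<^sup>2\<close>.\<close>
    have "(\<lambda>n. d n * r ^ (2 * n)) sums (9 * S)"
      using sums_mult[OF S(2), of 9]
      by (simp add: d_def norm_mult power_mult_distrib power_divide algebra_simps)
    with S(1) show ?thesis
      by (intro exI[of _ "9 * S"]) auto
  qed
  moreover have nonneg: "d n \<ge> 0" if "n \<ge> 3" for n
  proof -
    have "7\<^sup>2 \<le> (3 * real n)\<^sup>2"
      using that by (intro power_mono) auto
    then show ?thesis
      by (simp add: d_def)
  qed
  ultimately have d: "(\<Sum>n<N. d n) \<le> 0" if "N \<ge> 3" for N
    using that by (intro sum_le_zero_of_abel_means) auto
  have e: "(\<Sum>n<N. e n) \<le> 40" for N
  proof (cases N)
    case (Suc M)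
    \<comment> \<open>The bound 40 is the term \<open>d 1 = -40\<close> moved to the other
      side.\<close>
    have "(\<Sum>n<N + 2. d n) = d 0 + d 1 + (\<Sum>n<N. e n)"
      by (simp add: e_def sum.lessThan_Suc_shift del: sum.lessThan_Suc)
    moreover have "d 0 = 0" "d 1 = -40"
      by (simp_all add: d_def c_def)
    ultimately show ?thesis
      using d[of "N + 2"] Suc by simp
  qed simp
  \<comment> \<open>The term \<open>e 0\<close>, with weight 4 * (36 - 49) = -52, can be negative;
    the later ones are nonnegative with bounded partial sums.\<close>
  have "summable (\<lambda>n. e (Suc n))"
  proof (rule bounded_imp_summable)
    show "0 \<le> e (Suc n)" for n
      by (simp add: e_def nonneg)
    show "(\<Sum>n\<le>N. e (Suc n)) \<le> 40 - e 0" for N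
      using e[of "Suc (Suc N)"] unfolding lessThan_Suc_atMost sum.atMost_Suc_shift by simp
  qed
  then have "summable e"
    by (simp add: summable_Suc_iff)
  moreover from this have "suminf e \<le> 40"
    using e by (rule suminf_le_const)
  moreover have "e = (\<lambda>n. (real (n + 2))\<^sup>2 * ((3 * real (n + 2))\<^sup>2 - 7\<^sup>2) * (norm (a (n + 2)))\<^sup>2)"
    by (simp add: e_def d_def c_def fun_eq_iff)
  ultimately show ?thesis
    by simp
qed

end
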